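(* Let $G$ be a discrete group and let $(X,G)$ be a $G$-flow with enveloping semigroup $E(X,G)$. Then the flow $\bigl(E(X,G),G\bigr)$ is amenable if and only if $(X,G)$ is finitely power-hereditarily amenable.
   Context: All compact spaces are Hausdorff and all probability measures on compact spaces are regular Borel measures. A $G$-flow $(X,G)$ is a compact space $X$ with an action of the discrete group $G$ by homeomorphisms; a subflow is a nonempty closed $G$-invariant subset with the restricted action. A flow is amenable if it carries a $G$-invariant regular Borel probability measure. The enveloping semigroup $E(X,G)$ is the closure of $\{g_X:g\in G\}$ in $X^X$ with the product topology, where $g_X(x)=gx$; it is a semigroup under composition, and a $G$-flow under $g\cdot p:=g_X\circ p$. The flow $(X,G)$ is finitely power-hereditarily amenable if for every $n\geqslant 1$, every subflow of $X^n$, equipped with the diagonal action $g(x_1,\dots,x_n)=(gx_1,\dots,gx_n)$, carries a $G$-invariant regular Borel probability measure. (No tameness is assumed.) *)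

theory Defs
  imports "HOL-Probability.Probability" "HOL-Algebra.Group_Action"
begin

section \<open>Flows\<close>

text \<open>A flow lives on the carrier \<open>topspace X\<close>. By the library's \<open>group_action\<close>, each
  \<open>\<phi> g\<close> is a bijection of \<open>topspace X\<close> that is extensional, i.e. a point of
  \<open>topspace X \<rightarrow>\<^sub>E topspace X\<close>. The group is abstract and carries no topology.\<close>

definition G_flow :: "('g, 'm) monoid_scheme \<Rightarrow> 'a topology \<Rightarrow> ('g \<Rightarrow> 'a \<Rightarrow> 'a) \<Rightarrow> bool" where
  "G_flow G X \<phi> \<longleftrightarrow>
     compact_space X \<and> Hausdorff_space X \<and>
     group_action G (topspace X) \<phi> \<and>
     (\<forall>g\<in>carrier G. homeomorphic_map X X (\<phi> g))"

definition subflow :: "('g, 'm) monoid_scheme \<Rightarrow> 'a topology \<Rightarrow> ('g \<Rightarrow> 'a \<Rightarrow> 'a) \<Rightarrow> 'a set \<Rightarrow> bool" where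
  "subflow G X \<phi> Y \<longleftrightarrow>
     Y \<noteq> {} \<and> closedin X Y \<and> (\<forall>g\<in>carrier G. \<forall>y\<in>Y. \<phi> g y \<in> Y)"

definition restrict_action :: "('g \<Rightarrow> 'a \<Rightarrow> 'a) \<Rightarrow> 'a set \<Rightarrow> 'g \<Rightarrow> 'a \<Rightarrow> 'a" where
  "restrict_action \<phi> Y g = restrict (\<phi> g) Y"

text \<open>The power \<open>X\<^sup>n\<close> consists of the extensional functions \<open>{..<n} \<rightarrow>\<^sub>E topspace X\<close>.\<close>

definition power_space :: "'a topology \<Rightarrow> nat \<Rightarrow> (nat \<Rightarrow> 'a) topology" where
  "power_space X n = product_topology (\<lambda>_. X) {..<n}"

definition diagonal_action ::
    "'a topology \<Rightarrow> ('g \<Rightarrow> 'a \<Rightarrow> 'a) \<Rightarrow> nat \<Rightarrow> 'g \<Rightarrow> (nat \<Rightarrow> 'a) \<Rightarrow> nat \<Rightarrow> 'a" where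
  "diagonal_action X \<phi> n g = (\<lambda>x\<in>topspace (power_space X n). \<lambda>i\<in>{..<n}. \<phi> g (x i))"


section \<open>Amenability\<close>

definition borel_sigma :: "'a topology \<Rightarrow> 'a measure" where
  "borel_sigma X = sigma (topspace X) {U. openin X U}"

definition regular_borel_prob :: "'a topology \<Rightarrow> 'a measure \<Rightarrow> bool" where
  "regular_borel_prob X \<mu> \<longleftrightarrow>
     prob_space \<mu> \<and> sets \<mu> = sets (borel_sigma X) \<and>
     (\<forall>A\<in>sets \<mu>.
        emeasure \<mu> A = (INF U\<in>{U. openin X U \<and> A \<subseteq> U}. emeasure \<mu> U) \<and>
        emeasure \<mu> A = (SUP K\<in>{K. compactin X K \<and> K \<subseteq> A}. emeasure \<mu> K))"

definition amenable_flow ::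
    "('g, 'm) monoid_scheme \<Rightarrow> 'a topology \<Rightarrow> ('g \<Rightarrow> 'a \<Rightarrow> 'a) \<Rightarrow> bool" where
  "amenable_flow G X \<phi> \<longleftrightarrow>
     G_flow G X \<phi> \<and>
     (\<exists>\<mu>. regular_borel_prob X \<mu> \<and> (\<forall>g\<in>carrier G. distr \<mu> \<mu> (\<phi> g) = \<mu>))"

definition finitely_power_hereditarily_amenable ::
    "('g, 'm) monoid_scheme \<Rightarrow> 'a topology \<Rightarrow> ('g \<Rightarrow> 'a \<Rightarrow> 'a) \<Rightarrow> bool" where
  "finitely_power_hereditarily_amenable G X \<phi> \<longleftrightarrow>
     (\<forall>n\<ge>1. \<forall>Y. subflow G (power_space X n) (diagonal_action X \<phi> n) Y \<longrightarrow>
        amenable_flow G (subtopology (power_space X n) Y)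
          (restrict_action (diagonal_action X \<phi> n) Y))"


section \<open>The enveloping semigroup\<close>

definition self_maps_space :: "'a topology \<Rightarrow> ('a \<Rightarrow> 'a) topology" where
  "self_maps_space X = product_topology (\<lambda>_. X) (topspace X)"

definition enveloping_semigroup ::
    "('g, 'm) monoid_scheme \<Rightarrow> 'a topology \<Rightarrow> ('g \<Rightarrow> 'a \<Rightarrow> 'a) \<Rightarrow> ('a \<Rightarrow> 'a) set" where
  "enveloping_semigroup G X \<phi> = self_maps_space X closure_of (\<phi> ` carrier G)"

definition enveloping_space ::
    "('g, 'm) monoid_scheme \<Rightarrow> 'a topology \<Rightarrow> ('g \<Rightarrow> 'a \<Rightarrow> 'a) \<Rightarrow> ('a \<Rightarrow> 'a) topology" where
  "enveloping_space G X \<phi> = subtopology (self_maps_space X) (enveloping_semigroup G X \<phi>)"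

definition enveloping_action ::
    "('g, 'm) monoid_scheme \<Rightarrow> 'a topology \<Rightarrow> ('g \<Rightarrow> 'a \<Rightarrow> 'a) \<Rightarrow> 'g \<Rightarrow> ('a \<Rightarrow> 'a) \<Rightarrow> 'a \<Rightarrow> 'a" where
  "enveloping_action G X \<phi> g =
     (\<lambda>p\<in>enveloping_semigroup G X \<phi>. compose (topspace X) (\<phi> g) p)"


section \<open>The constructions above are flows\<close>

lemma G_flowI:
  assumes G: "group G" and comp: "compact_space X" and haus: "Hausdorff_space X"
    and ext: "\<And>g. g \<in> carrier G \<Longrightarrow> \<psi> g \<in> extensional (topspace X)"
    and cont: "\<And>g. g \<in> carrier G \<Longrightarrow> continuous_map X X (\<psi> g)"
    and one: "\<And>x. x \<in> topspace X \<Longrightarrow> \<psi> \<one>\<^bsub>G\<^esub> x = x"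
    and mult: "\<And>g h x. g \<in> carrier G \<Longrightarrow> h \<in> carrier G \<Longrightarrow> x \<in> topspace X
      \<Longrightarrow> \<psi> (g \<otimes>\<^bsub>G\<^esub> h) x = \<psi> g (\<psi> h x)"
  shows "G_flow G X \<psi>"
proof -
  interpret group G by (rule G)
  have mem: "\<psi> g x \<in> topspace X" if "g \<in> carrier G" "x \<in> topspace X" for g x
    using cont[OF that(1)] that(2) by (auto simp: continuous_map_def)
  have maps: "homeomorphic_maps X X (\<psi> g) (\<psi> (inv\<^bsub>G\<^esub> g))" if g: "g \<in> carrier G" for g
    unfolding homeomorphic_maps_def
    using g cont mult[of "inv\<^bsub>G\<^esub> g" g] mult[of g "inv\<^bsub>G\<^esub> g"] one by auto
  then have homeo: "homeomorphic_map X X (\<psi> g)" if "g \<in> carrier G" for g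
    using that homeomorphic_map_maps by blast
  have bij: "\<psi> g \<in> Bij (topspace X)" if "g \<in> carrier G" for g
    using homeo[OF that] ext[OF that]
    by (auto simp: Bij_def bij_betw_def homeomorphic_imp_surjective_map
        homeomorphic_imp_injective_map)
  have "\<psi> (g \<otimes>\<^bsub>G\<^esub> h) = compose (topspace X) (\<psi> g) (\<psi> h)"
    if "g \<in> carrier G" "h \<in> carrier G" for g h
    using that ext[of "g \<otimes>\<^bsub>G\<^esub> h"] mult
    by (intro extensionalityI[where A = "topspace X"]) (auto simp: compose_def)
  then have "\<psi> \<in> hom G (BijGroup (topspace X))"
    using bij by (auto simp: hom_def BijGroup_def)
  then have "group_action G (topspace X) \<psi>"
    by (simp add: group_action_def group_hom_def group_hom_axioms_def group_BijGroup G)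
  then show ?thesis
    using comp haus homeo by (simp add: G_flow_def)
qed

lemma G_flowD:
  assumes "G_flow G X \<phi>"
  shows "group G" "compact_space X" "Hausdorff_space X"
    and "\<And>g. g \<in> carrier G \<Longrightarrow> \<phi> g \<in> extensional (topspace X)"
    and "\<And>g. g \<in> carrier G \<Longrightarrow> continuous_map X X (\<phi> g)"
    and "\<And>g x. g \<in> carrier G \<Longrightarrow> x \<in> topspace X \<Longrightarrow> \<phi> g x \<in> topspace X"
    and "\<And>x. x \<in> topspace X \<Longrightarrow> \<phi> \<one>\<^bsub>G\<^esub> x = x"
    and "\<And>g h x. g \<in> carrier G \<Longrightarrow> h \<in> carrier G \<Longrightarrow> x \<in> topspace X
      \<Longrightarrow> \<phi> (g \<otimes>\<^bsub>G\<^esub> h) x = \<phi> g (\<phi> h x)"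
proof -
  interpret group_action G "topspace X" \<phi>
    using assms by (simp add: G_flow_def)
  show "group G" "compact_space X" "Hausdorff_space X"
    using assms group_hom by (auto simp: G_flow_def group_hom_def)
  show "\<And>g. g \<in> carrier G \<Longrightarrow> \<phi> g \<in> extensional (topspace X)"
    using bij_prop0 group_hom by (auto simp: group_hom_def group_hom_axioms_def hom_def BijGroup_def Bij_def)
  show "\<And>g. g \<in> carrier G \<Longrightarrow> continuous_map X X (\<phi> g)"
    using assms by (simp add: G_flow_def homeomorphic_imp_continuous_map)
  show "\<And>g x. g \<in> carrier G \<Longrightarrow> x \<in> topspace X \<Longrightarrow> \<phi> g x \<in> topspace X"
    using element_image by blast
  show "\<And>x. x \<in> topspace X \<Longrightarrow> \<phi> \<one>\<^bsub>G\<^esub> x = x"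
    using id_eq_one by (metis restrict_apply')
  show "\<And>g h x. g \<in> carrier G \<Longrightarrow> h \<in> carrier G \<Longrightarrow> x \<in> topspace X
      \<Longrightarrow> \<phi> (g \<otimes>\<^bsub>G\<^esub> h) x = \<phi> g (\<phi> h x)"
    using composition_rule by blast
qed

lemma G_flow_subflow:
  assumes X: "G_flow G X \<phi>" and Y: "subflow G X \<phi> Y"
  shows "G_flow G (subtopology X Y) (restrict_action \<phi> Y)"
proof -
  note D = G_flowD[OF X]
  have closed: "closedin X Y" and inv: "\<And>g y. g \<in> carrier G \<Longrightarrow> y \<in> Y \<Longrightarrow> \<phi> g y \<in> Y"
    using Y by (auto simp: subflow_def)
  have sub: "Y \<subseteq> topspace X" using closed by (rule closedin_subset)
  then have top: "topspace (subtopology X Y) = Y" by auto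
  interpret group G by (rule D)
  show ?thesis
  proof (rule G_flowI)
    show "compact_space (subtopology X Y)"
      using closed D(2) closedin_compact_space compact_space_subtopology by blast
    show "Hausdorff_space (subtopology X Y)"
      using D(3) by (rule Hausdorff_space_subtopology)
    show "continuous_map (subtopology X Y) (subtopology X Y) (restrict_action \<phi> Y g)"
      if g: "g \<in> carrier G" for g
      unfolding restrict_action_def
      by (rule continuous_map_eq[where f = "\<phi> g"])
        (use D(5)[OF g] inv[OF g] top in
          \<open>auto simp: continuous_map_in_subtopology continuous_map_from_subtopology\<close>)
  qed (use sub inv D in \<open>auto simp: restrict_action_def top subset_iff\<close>)
qed

lemma G_flow_power:
  assumes X: "G_flow G X \<phi>"
  shows "G_flow G (power_space X n) (diagonal_action X \<phi> n)"
proof -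
  note D = G_flowD[OF X]
  interpret group G by (rule D)
  show ?thesis
  proof (rule G_flowI)
    show "continuous_map (power_space X n) (power_space X n) (diagonal_action X \<phi> n g)"
      if g: "g \<in> carrier G" for g
      unfolding diagonal_action_def
      by (rule continuous_map_eq[where f = "\<lambda>x. \<lambda>i\<in>{..<n}. \<phi> g (x i)"])
        (auto simp: power_space_def continuous_map_componentwise
          intro!: continuous_map_compose[OF _ D(5)[OF g], unfolded o_def]
            continuous_map_product_projection)
  qed (use D in \<open>auto simp: power_space_def diagonal_action_def compact_space_product_topology
      Hausdorff_space_product_topology PiE_iff extensional_def fun_eq_iff\<close>)
qed

lemma G_flow_enveloping:
  assumes X: "G_flow G X \<phi>"
  shows "G_flow G (enveloping_space G X \<phi>) (enveloping_action G X \<phi>)"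
proof -
  note D = G_flowD[OF X]
  interpret group G by (rule D)
  let ?c = "\<lambda>g p. compose (topspace X) (\<phi> g) p"
  have top: "topspace (self_maps_space X) = topspace X \<rightarrow>\<^sub>E topspace X"
    by (simp add: self_maps_space_def)
  have cont: "continuous_map (self_maps_space X) (self_maps_space X) (?c g)"
    if g: "g \<in> carrier G" for g
    by (auto simp: self_maps_space_def compose_def continuous_map_componentwise
          intro!: continuous_map_compose[OF _ D(5)[OF g], unfolded o_def]
            continuous_map_product_projection)
  have flow: "G_flow G (self_maps_space X) (\<lambda>g. restrict (?c g) (topspace X \<rightarrow>\<^sub>E topspace X))"
  proof (rule G_flowI)
    show "continuous_map (self_maps_space X) (self_maps_space X)
        (restrict (?c g) (topspace X \<rightarrow>\<^sub>E topspace X))" if g: "g \<in> carrier G" for g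
      by (rule continuous_map_eq[OF cont[OF g]]) (simp add: top)
    show "compact_space (self_maps_space X)" "Hausdorff_space (self_maps_space X)"
      using D(2,3) by (auto simp: self_maps_space_def compact_space_product_topology
        Hausdorff_space_product_topology)
  qed (use D in \<open>auto simp: top compose_def PiE_iff extensional_def fun_eq_iff\<close>)
  have orbit: "?c g ` (\<phi> ` carrier G) \<subseteq> \<phi> ` carrier G" if g: "g \<in> carrier G" for g
  proof clarsimp
    fix h assume h: "h \<in> carrier G"
    have "?c g (\<phi> h) = \<phi> (g \<otimes>\<^bsub>G\<^esub> h)"
      using g h D(4)[of "g \<otimes>\<^bsub>G\<^esub> h"] D(8)
      by (intro extensionalityI[where A = "topspace X"]) (auto simp: compose_def)
    then show "?c g (\<phi> h) \<in> \<phi> ` carrier G" using g h by auto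
  qed
  have "\<phi> ` carrier G \<subseteq> topspace (self_maps_space X)"
    using D(4,6) by (auto simp: top PiE_def)
  then have "\<phi> \<one>\<^bsub>G\<^esub> \<in> enveloping_semigroup G X \<phi>"
    using closure_of_subset unfolding enveloping_semigroup_def by blast
  moreover have inE: "?c g p \<in> enveloping_semigroup G X \<phi>"
    if g: "g \<in> carrier G" and p: "p \<in> enveloping_semigroup G X \<phi>" for g p
    using continuous_map_image_closure_subset[OF cont[OF g], of "\<phi> ` carrier G"] p
      closure_of_mono[OF orbit[OF g], of "self_maps_space X"]
    unfolding enveloping_semigroup_def by blast
  moreover have E: "enveloping_semigroup G X \<phi> \<subseteq> topspace X \<rightarrow>\<^sub>E topspace X"
    unfolding enveloping_semigroup_def top[symmetric] by (rule closure_of_subset_topspace)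
  ultimately have "subflow G (self_maps_space X)
      (\<lambda>g. restrict (?c g) (topspace X \<rightarrow>\<^sub>E topspace X)) (enveloping_semigroup G X \<phi>)"
    by (auto simp: subflow_def subset_iff) (simp add: enveloping_semigroup_def)
  from G_flow_subflow[OF flow this]
  have "G_flow G (enveloping_space G X \<phi>)
      (restrict_action (\<lambda>g. restrict (?c g) (topspace X \<rightarrow>\<^sub>E topspace X)) (enveloping_semigroup G X \<phi>))"
    by (simp add: enveloping_space_def)
  moreover have "restrict_action (\<lambda>g. restrict (?c g) (topspace X \<rightarrow>\<^sub>E topspace X))
      (enveloping_semigroup G X \<phi>) = enveloping_action G X \<phi>"
    using E by (auto simp: restrict_action_def enveloping_action_def fun_eq_iff Int_absorb2)
  ultimately show ?thesis by simp
qed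

end

theory Submission
  imports Defs
begin

text \<open>If \<open>E(X,G)\<close> carries an invariant measure, then so does each subflow \<open>Y\<close> of \<open>X\<^sup>n\<close>: choose
  \<open>(x\<^sub>1, \<dots>, x\<^sub>n) \<in> Y\<close> and push the measure forward along the equivariant continuous map
  \<open>p \<mapsto> (p x\<^sub>1, \<dots>, p x\<^sub>n)\<close>, which takes its values in the orbit closure of the tuple and thus in
  \<open>Y\<close> (\<open>amenable_flow_equivariant_image\<close>, \<open>evaluate_in_subflow\<close>).

  Conversely, \<open>E(X,G)\<close> is the inverse limit of the orbit closures of all finite tuples. Each of
  these carries an invariant measure, but the measures for different tuples need not be
  compatible, so some limit must be taken. The limit is taken here at the level of set functions on
  closed sets. A tuple \<open>x\<close> with invariant measure \<open>\<mu>\<^sub>x\<close> on its orbit closure assigns to a closed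
  \<open>K \<subseteq> E(X,G)\<close> the number \<open>\<mu>\<^sub>x (K x)\<close>, where \<open>K x\<close> is the set of all \<open>(p x\<^sub>1, \<dots>, p x\<^sub>n)\<close>
  with \<open>p \<in> K\<close>. This set function is invariant and subadditive since \<open>(K \<union> L) x = K x \<union> L x\<close>, and
  it is additive on a disjoint pair \<open>K\<close>, \<open>L\<close> as soon as \<open>K x\<close> and \<open>L x\<close> are disjoint. By
  compactness of \<open>K \<times> L\<close>, the latter holds once \<open>x\<close> contains finitely many suitable coordinates
  (\<open>finitely_many_coordinates_separate\<close>). Hence finitely many disjoint pairs can be handled by one
  tuple, and compactness of a cube \<open>[0,1]\<^sup>I\<close> yields an invariant set function that is
  additive on all disjoint pairs (\<open>content_by_compactness\<close>). Such a content induces a regular Borel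
  measure by the classical construction through inner values of open sets and Caratheodory's
  theorem (\<open>regular_measure_exists\<close>), and this measure inherits the invariance.\<close>

section \<open>Borel measures on compact spaces\<close>

lemma space_borel_sigma [simp]: "space (borel_sigma X) = topspace X"
  by (simp add: borel_sigma_def space_measure_of_conv)

lemma sets_borel_sigma: "sets (borel_sigma X) = sigma_sets (topspace X) {U. openin X U}"
  unfolding borel_sigma_def by (rule sets_measure_of) (auto dest: openin_subset)

lemma openin_imp_sets: "openin X U \<Longrightarrow> U \<in> sets (borel_sigma X)"
  by (auto simp: sets_borel_sigma)

lemma closedin_imp_sets:
  assumes "closedin X K"
  shows "K \<in> sets (borel_sigma X)"
proof -
  have "topspace X - (topspace X - K) \<in> sets (borel_sigma X)"
    using assms openin_imp_sets[of X "topspace X - K"] sets.compl_sets[of _ "borel_sigma X"]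
    by (auto simp: closedin_def)
  moreover have "topspace X - (topspace X - K) = K"
    using closedin_subset[OF assms] by blast
  ultimately show ?thesis by simp
qed

lemma continuous_map_measurable:
  assumes "continuous_map X Y f"
  shows "f \<in> measurable (borel_sigma X) (borel_sigma Y)"
proof -
  have "f \<in> measurable (borel_sigma X) (sigma (topspace Y) {U. openin Y U})"
  proof (rule measurable_measure_of)
    fix U assume "U \<in> {U. openin Y U}"
    then have "openin X {x \<in> topspace X. f x \<in> U}"
      using assms by (simp add: continuous_map_def)
    moreover have "f -` U \<inter> space (borel_sigma X) = {x \<in> topspace X. f x \<in> U}" by auto
    ultimately show "f -` U \<inter> space (borel_sigma X) \<in> sets (borel_sigma X)"
      by (simp add: openin_imp_sets)
  qed (use assms in \<open>auto simp: continuous_map_def dest: openin_subset\<close>)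
  then show ?thesis by (simp add: borel_sigma_def)
qed

lemma regular_borel_probD:
  assumes "regular_borel_prob X \<mu>"
  shows "prob_space \<mu>" "sets \<mu> = sets (borel_sigma X)" "space \<mu> = topspace X"
    and "\<And>A. A \<in> sets \<mu> \<Longrightarrow> emeasure \<mu> A = (INF U\<in>{U. openin X U \<and> A \<subseteq> U}. emeasure \<mu> U)"
  using assms sets_eq_imp_space_eq[of \<mu> "borel_sigma X"] by (auto simp: regular_borel_prob_def)

text \<open>In a compact space, complements turn approximation from outside by open sets into
  approximation from inside by compact sets.\<close>

lemma regular_borel_probI:
  assumes comp: "compact_space X" and prob: "prob_space \<mu>"
    and sets: "sets \<mu> = sets (borel_sigma X)"
    and outer: "\<And>A. A \<in> sets \<mu> \<Longrightarrow>
      (INF U\<in>{U. openin X U \<and> A \<subseteq> U}. emeasure \<mu> U) \<le> emeasure \<mu> A"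
  shows "regular_borel_prob X \<mu>"
proof -
  interpret prob_space \<mu> by (rule prob)
  have space: "space \<mu> = topspace X"
    using sets_eq_imp_space_eq[OF sets] by simp
  have opens: "U \<in> sets \<mu>" if "openin X U" for U
    using that sets openin_imp_sets by blast
  have outer_eq: "emeasure \<mu> A = (INF U\<in>{U. openin X U \<and> A \<subseteq> U}. emeasure \<mu> U)"
    if "A \<in> sets \<mu>" for A
    using outer[OF that] opens by (intro antisym INF_greatest) (auto intro: emeasure_mono)
  have inner_eq: "emeasure \<mu> A = (SUP K\<in>{K. compactin X K \<and> K \<subseteq> A}. emeasure \<mu> K)"
    if A: "A \<in> sets \<mu>" for A
  proof (rule antisym)
    have sub: "A \<subseteq> topspace X" using sets.sets_into_space[OF A] space by simp
    let ?B = "topspace X - A"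
    let ?\<U> = "{U. openin X U \<and> ?B \<subseteq> U}"
    have B: "?B \<in> sets \<mu>" using sets.compl_sets[OF A] space by simp
    have "emeasure \<mu> A = emeasure \<mu> (space \<mu> - ?B)"
      using sub space by (simp add: double_diff)
    also have "\<dots> = 1 - emeasure \<mu> ?B"
      using B emeasure_compl[of ?B \<mu>] emeasure_space_1 by simp
    also have "\<dots> = (SUP U\<in>?\<U>. 1 - emeasure \<mu> U)"
      using outer_eq[OF B] by (subst ennreal_INF_const_minus) auto
    also have "\<dots> \<le> (SUP K\<in>{K. compactin X K \<and> K \<subseteq> A}. emeasure \<mu> K)"
    proof (rule SUP_least)
      fix U assume U: "U \<in> ?\<U>"
      then have "closedin X (topspace X - U)" by (simp add: openin_closedin_eq)
      then have K: "compactin X (topspace X - U)" by (rule closedin_compact_space[OF comp])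
      have "1 - emeasure \<mu> U = emeasure \<mu> (topspace X - U)"
        using U opens emeasure_compl[of U \<mu>] emeasure_space_1 space by simp
      also have "\<dots> \<le> (SUP K\<in>{K. compactin X K \<and> K \<subseteq> A}. emeasure \<mu> K)"
        using U K by (intro SUP_upper) auto
      finally show "1 - emeasure \<mu> U \<le> (SUP K\<in>{K. compactin X K \<and> K \<subseteq> A}. emeasure \<mu> K)" .
    qed
    finally show "emeasure \<mu> A \<le> (SUP K\<in>{K. compactin X K \<and> K \<subseteq> A}. emeasure \<mu> K)" .
    show "(SUP K\<in>{K. compactin X K \<and> K \<subseteq> A}. emeasure \<mu> K) \<le> emeasure \<mu> A"
      using A by (auto intro!: SUP_least emeasure_mono)
  qed
  show ?thesis
    unfolding regular_borel_prob_def using prob sets outer_eq inner_eq by blast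
qed

lemma finite_borel_measure_eqI:
  assumes "finite_measure \<mu>" "sets \<mu> = sets (borel_sigma X)" "sets \<nu> = sets (borel_sigma X)"
    and "\<And>U. openin X U \<Longrightarrow> emeasure \<mu> U = emeasure \<nu> U"
  shows "\<mu> = \<nu>"
proof (rule measure_eqI_generator_eq[where \<Omega> = "topspace X" and E = "{U. openin X U}"
      and A = "\<lambda>_. topspace X"])
  show "Int_stable {U. openin X U}" by (auto simp: Int_stable_def)
  show "emeasure \<mu> (topspace X) \<noteq> \<infinity>" for i :: nat
    using finite_measure.emeasure_finite[OF assms(1)] by simp
qed (use assms in \<open>auto simp: sets_borel_sigma dest: openin_subset\<close>)

text \<open>The push-forward is outer regular because a continuous map between compact Hausdorff spaces
  is closed: if the open set \<open>V\<close> contains the preimage of \<open>A\<close>, then the complement of the image of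
  the complement of \<open>V\<close> is an open set around \<open>A\<close> whose preimage lies in \<open>V\<close>.\<close>

lemma amenable_flow_equivariant_image:
  assumes amen: "amenable_flow G X \<phi>" and Y: "G_flow G Y \<psi>"
    and f: "continuous_map X Y f"
    and equiv: "\<And>g x. g \<in> carrier G \<Longrightarrow> x \<in> topspace X \<Longrightarrow> f (\<phi> g x) = \<psi> g (f x)"
  shows "amenable_flow G Y \<psi>"
proof -
  from amen obtain \<mu> where X: "G_flow G X \<phi>" and \<mu>: "regular_borel_prob X \<mu>"
    and inv: "\<And>g. g \<in> carrier G \<Longrightarrow> distr \<mu> \<mu> (\<phi> g) = \<mu>"
    by (auto simp: amenable_flow_def)
  note DX = G_flowD[OF X] and DY = G_flowD[OF Y] and R = regular_borel_probD[OF \<mu>]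
  interpret prob_space \<mu> by (rule R)
  let ?B = "borel_sigma Y"
  have fm: "f \<in> measurable \<mu> ?B"
    using continuous_map_measurable[OF f] measurable_cong_sets[OF R(2) refl] by blast
  define \<nu> where "\<nu> = distr \<mu> ?B f"
  have sets: "sets \<nu> = sets ?B" by (simp add: \<nu>_def)
  have prob: "prob_space \<nu>" unfolding \<nu>_def by (rule prob_space_distr[OF fm])
  have em: "emeasure \<nu> A = emeasure \<mu> (f -` A \<inter> topspace X)" if "A \<in> sets ?B" for A
    using that fm R(3) by (simp add: \<nu>_def emeasure_distr)
  have closed_map: "closed_map X Y f"
    using DX(2) DY(3) f by (simp add: Hausdorff_imp_kc_space continuous_imp_closed_map_gen)
  have "regular_borel_prob Y \<nu>"
  proof (rule regular_borel_probI[OF DY(2) prob sets])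
    fix A assume A: "A \<in> sets \<nu>"
    then have A': "A \<in> sets ?B" by (simp add: sets)
    let ?P = "f -` A \<inter> topspace X"
    have P: "?P \<in> sets \<mu>" using measurable_sets[OF fm A'] R(3) by simp
    have "(INF U\<in>{U. openin Y U \<and> A \<subseteq> U}. emeasure \<nu> U)
        \<le> (INF V\<in>{V. openin X V \<and> ?P \<subseteq> V}. emeasure \<mu> V)"
    proof (rule INF_greatest)
      fix V assume V: "V \<in> {V. openin X V \<and> ?P \<subseteq> V}"
      let ?U = "topspace Y - f ` (topspace X - V)"
      have "closedin Y (f ` (topspace X - V))"
        using closed_map V by (auto simp: closed_map_def)
      then have U: "openin Y ?U" by blast
      have "A \<subseteq> ?U" using V sets.sets_into_space[OF A'] by auto
      then have "(INF U\<in>{U. openin Y U \<and> A \<subseteq> U}. emeasure \<nu> U) \<le> emeasure \<nu> ?U"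
        using U by (intro INF_lower) auto
      also have "\<dots> = emeasure \<mu> (f -` ?U \<inter> topspace X)"
        using U by (intro em openin_imp_sets)
      also have "\<dots> \<le> emeasure \<mu> V"
        using V R(2) openin_imp_sets[of X V] by (intro emeasure_mono) auto
      finally show "(INF U\<in>{U. openin Y U \<and> A \<subseteq> U}. emeasure \<nu> U) \<le> emeasure \<mu> V" .
    qed
    also have "\<dots> = emeasure \<nu> A" using R(4)[OF P] em[OF A'] by simp
    finally show "(INF U\<in>{U. openin Y U \<and> A \<subseteq> U}. emeasure \<nu> U) \<le> emeasure \<nu> A" .
  qed
  moreover have "distr \<nu> \<nu> (\<psi> g) = \<nu>" if g: "g \<in> carrier G" for g
  proof -
    have \<psi>m: "\<psi> g \<in> measurable ?B ?B"
      by (rule continuous_map_measurable[OF DY(5)[OF g]])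
    have \<phi>m: "\<phi> g \<in> measurable \<mu> \<mu>"
      using continuous_map_measurable[OF DX(5)[OF g]] measurable_cong_sets[OF R(2) R(2)] by simp
    have "distr \<nu> \<nu> (\<psi> g) = distr \<nu> ?B (\<psi> g)"
      by (rule distr_cong) (auto simp: sets)
    also have "\<dots> = distr \<mu> ?B (\<psi> g \<circ> f)"
      unfolding \<nu>_def by (rule distr_distr[OF \<psi>m fm])
    also have "\<dots> = distr \<mu> ?B (f \<circ> \<phi> g)"
      by (rule distr_cong) (auto simp: equiv[OF g] R(3))
    also have "\<dots> = distr (distr \<mu> \<mu> (\<phi> g)) ?B f"
      by (rule distr_distr[OF fm \<phi>m, symmetric])
    also have "\<dots> = \<nu>" by (simp add: inv[OF g] \<nu>_def)
    finally show ?thesis .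
  qed
  ultimately show ?thesis using Y by (auto simp: amenable_flow_def)
qed


section \<open>From contents on closed sets to regular measures\<close>

text \<open>A subcontent is what a probability measure on a quotient induces on closed sets by
  \<open>K \<mapsto> \<mu> (f ` K)\<close>; additivity may fail because \<open>f\<close> can glue disjoint sets together.\<close>

locale subcontent =
  fixes X :: "'a topology" and \<kappa> :: "'a set \<Rightarrow> real"
  assumes bounds: "0 \<le> \<kappa> K \<and> \<kappa> K \<le> 1"
    and total: "\<kappa> (topspace X) = 1"
    and subadd: "closedin X K \<Longrightarrow> closedin X L \<Longrightarrow> \<kappa> (K \<union> L) \<le> \<kappa> K + \<kappa> L"

locale content = subcontent +
  assumes compact: "compact_space X" and Hausdorff: "Hausdorff_space X"
    and additive: "closedin X K \<Longrightarrow> closedin X L \<Longrightarrow> K \<inter> L = {} \<Longrightarrow> \<kappa> (K \<union> L) = \<kappa> K + \<kappa> L"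
begin

definition inner_content :: "'a set \<Rightarrow> ennreal" where
  "inner_content U = (SUP K\<in>{K. closedin X K \<and> K \<subseteq> U}. ennreal (\<kappa> K))"

definition outer_content :: "'a set \<Rightarrow> ennreal" where
  "outer_content A = (INF U\<in>{U. openin X U \<and> A \<subseteq> U}. inner_content U)"

lemma content_empty: "\<kappa> {} = 0"
  using additive[of "{}" "{}"] by simp

lemma le_inner_content: "closedin X K \<Longrightarrow> K \<subseteq> U \<Longrightarrow> ennreal (\<kappa> K) \<le> inner_content U"
  unfolding inner_content_def by (rule SUP_upper) simp

lemma inner_content_leI: "(\<And>K. closedin X K \<Longrightarrow> K \<subseteq> U \<Longrightarrow> ennreal (\<kappa> K) \<le> c) \<Longrightarrow> inner_content U \<le> c"
  unfolding inner_content_def by (rule SUP_least) simp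

lemma inner_content_mono: "U \<subseteq> V \<Longrightarrow> inner_content U \<le> inner_content V"
  by (intro inner_content_leI le_inner_content) auto

lemma inner_content_empty: "inner_content {} = 0"
  using inner_content_leI[of "{}" 0] by (simp add: content_empty)

lemma inner_content_space: "inner_content (topspace X) = 1"
proof (rule antisym)
  show "inner_content (topspace X) \<le> 1"
    using bounds by (intro inner_content_leI) simp
  show "1 \<le> inner_content (topspace X)"
    using le_inner_content[of "topspace X" "topspace X"] total by simp
qed

lemma outer_content_le: "openin X U \<Longrightarrow> A \<subseteq> U \<Longrightarrow> outer_content A \<le> inner_content U"
  unfolding outer_content_def by (rule INF_lower) simp

lemma outer_content_geI: "(\<And>U. openin X U \<Longrightarrow> A \<subseteq> U \<Longrightarrow> c \<le> inner_content U) \<Longrightarrow> c \<le> outer_content A"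
  unfolding outer_content_def by (rule INF_greatest) simp

lemma outer_content_mono: "A \<subseteq> B \<Longrightarrow> outer_content A \<le> outer_content B"
  by (intro outer_content_geI outer_content_le) auto

lemma outer_content_open: "openin X U \<Longrightarrow> outer_content U = inner_content U"
  by (intro antisym outer_content_le outer_content_geI inner_content_mono) auto

text \<open>Because \<open>X\<close> is normal, a closed subset of \<open>U \<union> V\<close> is the union of a closed subset of \<open>U\<close> and one
  of \<open>V\<close>.\<close>

lemma inner_content_Un:
  assumes U: "openin X U" and V: "openin X V"
  shows "inner_content (U \<union> V) \<le> inner_content U + inner_content V"
proof (rule inner_content_leI)
  fix K assume K: "closedin X K" "K \<subseteq> U \<union> V"
  have "normal_space X"
    using compact Hausdorff compact_Hausdorff_or_regular_imp_normal_space by blast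
  moreover have "closedin X (K - U)" "closedin X (K - V)"
    using K U V by auto
  moreover have "disjnt (K - U) (K - V)"
    using K by (auto simp: disjnt_def)
  ultimately obtain A B where AB: "openin X A" "openin X B" "K - U \<subseteq> A" "K - V \<subseteq> B" "disjnt A B"
    unfolding normal_space_def by meson
  have cl: "closedin X (K - A)" "closedin X (K - B)" using AB K by auto
  have "K = (K - A) \<union> (K - B)" using AB by (auto simp: disjnt_def)
  then have "\<kappa> K \<le> \<kappa> (K - A) + \<kappa> (K - B)"
    using subadd[OF cl] by simp
  then have "ennreal (\<kappa> K) \<le> ennreal (\<kappa> (K - A)) + ennreal (\<kappa> (K - B))"
    using bounds by (simp add: ennreal_plus[symmetric] del: ennreal_plus)
  also have "\<dots> \<le> inner_content U + inner_content V"
    using AB cl by (intro add_mono le_inner_content) auto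
  finally show "ennreal (\<kappa> K) \<le> inner_content U + inner_content V" .
qed

lemma inner_content_UN_finite:
  fixes n :: nat
  assumes "\<And>i. openin X (U i)"
  shows "inner_content (\<Union>i<n. U i) \<le> (\<Sum>i<n. inner_content (U i))"
proof (induction n)
  case (Suc n)
  have "inner_content (\<Union>i<Suc n. U i) = inner_content ((\<Union>i<n. U i) \<union> U n)"
    by (simp add: lessThan_Suc Un_commute)
  also have "\<dots> \<le> inner_content (\<Union>i<n. U i) + inner_content (U n)"
    using assms by (intro inner_content_Un) auto
  also have "\<dots> \<le> (\<Sum>i<Suc n. inner_content (U i))"
    using Suc by (simp add: add_mono)
  finally show ?case .
qed (simp add: inner_content_empty)

text \<open>Compactness reduces a countable cover of a closed set to a finite one.\<close>

lemma inner_content_UN: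
  fixes U :: "nat \<Rightarrow> 'a set"
  assumes U: "\<And>i. openin X (U i)"
  shows "inner_content (\<Union>i. U i) \<le> (\<Sum>i. inner_content (U i))"
proof (rule inner_content_leI)
  fix K assume K: "closedin X K" "K \<subseteq> (\<Union>i. U i)"
  then obtain \<F> where \<F>: "finite \<F>" "\<F> \<subseteq> range U" "K \<subseteq> \<Union>\<F>"
    using closedin_compact_space[OF compact K(1)] U unfolding compactin_def
    by (metis (no_types, lifting) imageE)
  then obtain J where J: "finite J" "\<F> = U ` J"
    by (meson finite_subset_image)
  obtain n where "J \<subseteq> {..<n}" using J(1) finite_nat_iff_bounded by blast
  then have "K \<subseteq> (\<Union>i<n. U i)" using \<F> J by blast
  then have "ennreal (\<kappa> K) \<le> inner_content (\<Union>i<n. U i)" by (rule le_inner_content[OF K(1)])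
  also have "\<dots> \<le> (\<Sum>i<n. inner_content (U i))" using U by (rule inner_content_UN_finite)
  also have "\<dots> \<le> (\<Sum>i. inner_content (U i))" by (rule sum_le_suminf) auto
  finally show "ennreal (\<kappa> K) \<le> (\<Sum>i. inner_content (U i))" .
qed

lemma outer_content_UN:
  fixes A :: "nat \<Rightarrow> 'a set"
  shows "outer_content (\<Union>i. A i) \<le> (\<Sum>i. outer_content (A i))"
proof (rule ennreal_le_epsilon)
  fix e :: real assume e: "0 < e" and fin: "(\<Sum>i. outer_content (A i)) < top_class.top"
  then have "outer_content (A i) < outer_content (A i) + e * (1/2) ^ Suc i" for i
    by (auto simp: less_top dest!: ennreal_suminf_lessD)
  then have "\<exists>U. openin X U \<and> A i \<subseteq> U \<and> inner_content U < outer_content (A i) + e * (1/2) ^ Suc i" for i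
    unfolding outer_content_def INF_less_iff by auto
  then obtain U where U: "\<And>i. openin X (U i)" "\<And>i. A i \<subseteq> U i"
      and le: "\<And>i. inner_content (U i) < outer_content (A i) + e * (1/2) ^ Suc i"
    by metis
  have "outer_content (\<Union>i. A i) \<le> inner_content (\<Union>i. U i)"
    using U by (intro outer_content_le) auto
  also have "\<dots> \<le> (\<Sum>i. inner_content (U i))" using U(1) by (rule inner_content_UN)
  also have "\<dots> \<le> (\<Sum>i. outer_content (A i) + e * (1/2) ^ Suc i)"
    using le by (intro suminf_le) (auto intro: less_imp_le)
  also have "\<dots> = (\<Sum>i. outer_content (A i)) + (\<Sum>i. ennreal e * ennreal ((1/2) ^ Suc i))"
    using e by (subst suminf_add[symmetric])
      (auto simp del: ennreal_suminf_cmult simp add: ennreal_mult[symmetric])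
  also have "\<dots> = (\<Sum>i. outer_content (A i)) + e"
    unfolding ennreal_suminf_cmult
    by (subst suminf_ennreal_eq[OF zero_le_power power_half_series]) auto
  finally show "outer_content (\<Union>i. A i) \<le> (\<Sum>i. outer_content (A i)) + e" .
qed

lemma outer_measure_space_outer: "outer_measure_space (Pow (topspace X)) outer_content"
  unfolding outer_measure_space_def
proof (intro conjI)
  show "positive (Pow (topspace X)) outer_content"
    using outer_content_open[of "{}"] by (simp add: positive_def inner_content_empty)
  show "increasing (Pow (topspace X)) outer_content"
    by (simp add: increasing_def outer_content_mono)
  show "countably_subadditive (Pow (topspace X)) outer_content"
    by (simp add: countably_subadditive_def outer_content_UN)
qed

text \<open>This is the nontrivial half of Caratheodory's condition for open \<open>U\<close>. For \<open>V\<close> open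
  around \<open>A\<close>, exhaust \<open>V \<inter> U\<close> by closed sets \<open>K\<close> and then \<open>V - K\<close> by closed sets \<open>L\<close>; the
  content is additive on the disjoint pair \<open>K\<close>, \<open>L\<close>.\<close>

lemma outer_content_split:
  assumes U: "openin X U"
  shows "outer_content (A \<inter> U) + outer_content (A - U) \<le> outer_content A"
proof (rule outer_content_geI)
  fix V assume V: "openin X V" "A \<subseteq> V"
  have VU: "openin X (V \<inter> U)" using U V by auto
  have K_bound: "ennreal (\<kappa> K) + outer_content (A - U) \<le> inner_content V"
    if K: "closedin X K" "K \<subseteq> V \<inter> U" for K
  proof -
    have "outer_content (A - U) \<le> inner_content (V - K)"
      using V K by (intro outer_content_le) auto
    then have "ennreal (\<kappa> K) + outer_content (A - U) \<le> ennreal (\<kappa> K) + inner_content (V - K)"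
      by (intro add_mono) auto
    also have "\<dots> = (SUP L\<in>{L. closedin X L \<and> L \<subseteq> V - K}. ennreal (\<kappa> K) + ennreal (\<kappa> L))"
      unfolding inner_content_def by (rule ennreal_SUP_add_right) (auto intro: exI[of _ "{}"])
    also have "\<dots> \<le> inner_content V"
    proof (rule SUP_least)
      fix L assume L: "L \<in> {L. closedin X L \<and> L \<subseteq> V - K}"
      then have "\<kappa> (K \<union> L) = \<kappa> K + \<kappa> L" using K by (intro additive) auto
      then have "ennreal (\<kappa> K) + ennreal (\<kappa> L) = ennreal (\<kappa> (K \<union> L))"
        using bounds by (simp add: ennreal_plus)
      also have "\<dots> \<le> inner_content V" using K L by (intro le_inner_content) auto
      finally show "ennreal (\<kappa> K) + ennreal (\<kappa> L) \<le> inner_content V" .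
    qed
    finally show ?thesis .
  qed
  have "outer_content (A \<inter> U) + outer_content (A - U) \<le> inner_content (V \<inter> U) + outer_content (A - U)"
    using V VU by (intro add_mono outer_content_le) auto
  also have "\<dots> = (SUP K\<in>{K. closedin X K \<and> K \<subseteq> V \<inter> U}. ennreal (\<kappa> K) + outer_content (A - U))"
    unfolding inner_content_def by (rule ennreal_SUP_add_left[symmetric]) (auto intro: exI[of _ "{}"])
  also have "\<dots> \<le> inner_content V" using K_bound by (intro SUP_least) auto
  finally show "outer_content (A \<inter> U) + outer_content (A - U) \<le> inner_content V" .
qed

lemma regular_measure_exists:
  "\<exists>\<mu>. regular_borel_prob X \<mu> \<and> (\<forall>U. openin X U \<longrightarrow> emeasure \<mu> U = inner_content U)"
proof -
  let ?\<Omega> = "topspace X"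
  let ?S = "sets (borel_sigma X)"
  let ?L = "lambda_system ?\<Omega> (Pow ?\<Omega>) outer_content"
  interpret pow: sigma_algebra ?\<Omega> "Pow ?\<Omega>" by (rule sigma_algebra_Pow)
  have ms: "measure_space ?\<Omega> ?L outer_content"
    by (rule pow.caratheodory_lemma[OF outer_measure_space_outer])
  have "U \<in> ?L" if U: "openin X U" for U
  proof -
    have "outer_content (A \<inter> U) + outer_content (A - U) = outer_content A" for A
    proof (rule antisym)
      have "subadditive (Pow UNIV) outer_content"
        using outer_content_open[of "{}"] outer_content_UN
        by (intro ring_of_sets.countably_subadditive_subadditive[OF ring_of_sets_Pow])
          (auto simp: positive_def countably_subadditive_def inner_content_empty)
      then have "outer_content ((A \<inter> U) \<union> (A - U)) \<le> outer_content (A \<inter> U) + outer_content (A - U)"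
        by (rule subadditiveD) auto
      moreover have "(A \<inter> U) \<union> (A - U) = A" by blast
      ultimately show "outer_content A \<le> outer_content (A \<inter> U) + outer_content (A - U)" by simp
    qed (rule outer_content_split[OF U])
    then show ?thesis
      using openin_subset[OF U] by (auto simp: pow.lambda_system_eq)
  qed
  then have SL: "?S \<subseteq> ?L"
    using ms sigma_algebra.sigma_sets_subset[of ?\<Omega> ?L "{U. openin X U}"]
    by (auto simp: sets_borel_sigma measure_space_def)
  define \<mu> where "\<mu> = measure_of ?\<Omega> ?S outer_content"
  have sa: "sigma_algebra ?\<Omega> ?S"
    using sets.sigma_algebra_axioms[of "borel_sigma X"] by simp
  have pos: "positive ?S outer_content" and ca: "countably_additive ?S outer_content"
    using ms SL by (auto simp: measure_space_def positive_def countably_additive_def)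
  have sets: "sets \<mu> = ?S"
    unfolding \<mu>_def by (rule sigma_algebra.sets_measure_of_eq[OF sa])
  have space: "space \<mu> = ?\<Omega>"
    unfolding \<mu>_def by (rule sigma_algebra.space_measure_of_eq[OF sa])
  have em: "emeasure \<mu> A = outer_content A" if "A \<in> ?S" for A
    unfolding \<mu>_def by (rule emeasure_measure_of_sigma[OF sa pos ca that])
  have em_open: "emeasure \<mu> U = inner_content U" if "openin X U" for U
    using em[OF openin_imp_sets[OF that]] outer_content_open[OF that] by simp
  have "emeasure \<mu> (space \<mu>) = 1"
    using em_open[of ?\<Omega>] by (simp add: space inner_content_space)
  then have "prob_space \<mu>" by (rule prob_spaceI)
  then have "regular_borel_prob X \<mu>"
    using sets em em_open by (intro regular_borel_probI[OF compact]) (auto simp: outer_content_def)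
  then show ?thesis using em_open by blast
qed

end

text \<open>Invariance passes from the content to open sets, and finite Borel measures are determined by
  their values on open sets.\<close>

lemma amenable_flow_if_invariant_content:
  assumes X: "G_flow G X \<phi>" and \<kappa>: "content X \<kappa>"
    and inv: "\<And>g K. g \<in> carrier G \<Longrightarrow> closedin X K \<Longrightarrow> \<kappa> (\<phi> g ` K) = \<kappa> K"
  shows "amenable_flow G X \<phi>"
proof -
  interpret content X \<kappa> by (rule \<kappa>)
  note D = G_flowD[OF X]
  interpret group G by (rule D)
  obtain \<mu> where \<mu>: "regular_borel_prob X \<mu>" and open_eq: "\<And>U. openin X U \<Longrightarrow> emeasure \<mu> U = inner_content U"
    using regular_measure_exists by blast
  note R = regular_borel_probD[OF \<mu>]
  interpret prob_space \<mu> by (rule R)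
  have closed_image: "closedin X (\<phi> g ` K)" if "g \<in> carrier G" "closedin X K" for g K
    using X that homeomorphic_imp_closed_map[of X X "\<phi> g"] by (simp add: G_flow_def closed_map_def)
  have "distr \<mu> \<mu> (\<phi> g) = \<mu>" if g: "g \<in> carrier G" for g
  proof (rule finite_borel_measure_eqI[where X = X])
    have m: "\<phi> g \<in> measurable \<mu> \<mu>"
      using continuous_map_measurable[OF D(5)[OF g]] measurable_cong_sets[OF R(2) R(2)] by simp
    show "finite_measure (distr \<mu> \<mu> (\<phi> g))"
      by (rule finite_measure_distr[OF m])
    fix U assume U: "openin X U"
    let ?P = "{x \<in> topspace X. \<phi> g x \<in> U}"
    have P: "openin X ?P" using D(5)[OF g] U by (simp add: continuous_map_def)
    have "emeasure (distr \<mu> \<mu> (\<phi> g)) U = emeasure \<mu> (\<phi> g -` U \<inter> space \<mu>)"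
      using m U R(2) openin_imp_sets[OF U] by (simp add: emeasure_distr)
    also have "\<phi> g -` U \<inter> space \<mu> = ?P" using R(3) by auto
    also have "emeasure \<mu> ?P = inner_content ?P" by (rule open_eq[OF P])
    also have "\<dots> = inner_content U"
    proof (intro antisym inner_content_leI)
      fix K assume K: "closedin X K" "K \<subseteq> ?P"
      then have "ennreal (\<kappa> (\<phi> g ` K)) \<le> inner_content U"
        by (intro le_inner_content closed_image[OF g]) auto
      then show "ennreal (\<kappa> K) \<le> inner_content U" by (simp add: inv[OF g K(1)])
    next
      fix K assume K: "closedin X K" "K \<subseteq> U"
      have cancel: "\<phi> g (\<phi> (inv\<^bsub>G\<^esub> g) x) = x" if "x \<in> topspace X" for x
        using D(8)[OF g inv_closed[OF g] that] D(7)[OF that] r_inv[OF g] by simp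
      have "\<phi> (inv\<^bsub>G\<^esub> g) ` K \<subseteq> ?P"
        using K(2) closedin_subset[OF K(1)] cancel D(6)[OF inv_closed[OF g]]
        by (auto simp: subset_iff)
      then have "ennreal (\<kappa> (\<phi> (inv\<^bsub>G\<^esub> g) ` K)) \<le> inner_content ?P"
        by (rule le_inner_content[OF closed_image[OF inv_closed[OF g] K(1)]])
      then show "ennreal (\<kappa> K) \<le> inner_content ?P" by (simp add: inv[OF inv_closed[OF g] K(1)])
    qed
    also have "\<dots> = emeasure \<mu> U" using open_eq[OF U] by simp
    finally show "emeasure (distr \<mu> \<mu> (\<phi> g)) U = emeasure \<mu> U" .
  qed (use R(2) in simp_all)
  then show ?thesis unfolding amenable_flow_def using X \<mu> by blast
qed

text \<open>Every requirement on \<open>\<kappa>\<close> is a closed condition on a point of the compact cube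
  \<open>[0,1]\<^bsup>Pow X\<^esup>\<close>, so it is enough to satisfy additivity for finitely many pairs at a time.\<close>

lemma content_by_compactness:
  fixes X :: "'a topology" and H :: "('a \<Rightarrow> 'a) set"
  defines "pairs \<equiv> {(K, L). closedin X K \<and> closedin X L \<and> K \<inter> L = {}}"
  assumes comp: "compact_space X" and haus: "Hausdorff_space X"
    and approx: "\<And>P. finite P \<Longrightarrow> P \<subseteq> pairs \<Longrightarrow>
      \<exists>\<kappa>. subcontent X \<kappa> \<and> (\<forall>h K. h \<in> H \<longrightarrow> closedin X K \<longrightarrow> \<kappa> (h ` K) = \<kappa> K) \<and>
          (\<forall>(K, L)\<in>P. \<kappa> (K \<union> L) = \<kappa> K + \<kappa> L)"
  shows "\<exists>\<kappa>. content X \<kappa> \<and> (\<forall>h K. h \<in> H \<longrightarrow> closedin X K \<longrightarrow> \<kappa> (h ` K) = \<kappa> K)"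
proof -
  define D :: "'a set \<times> 'a set \<Rightarrow> ('a set \<Rightarrow> real) set" where
    "D = (\<lambda>(K, L). {\<kappa>. subcontent X \<kappa> \<and> (\<forall>h K. h \<in> H \<longrightarrow> closedin X K \<longrightarrow> \<kappa> (h ` K) = \<kappa> K) \<and>
       \<kappa> (K \<union> L) = \<kappa> K + \<kappa> L})"
  define cube :: "('a set \<Rightarrow> real) set" where "cube = (\<Pi>\<^sub>E i\<in>UNIV. {0..1})"
  have "compactin (product_topology (\<lambda>_. euclidean) UNIV) cube"
    by (simp add: cube_def compactin_PiE)
  then have "compact cube" by (simp add: euclidean_product_topology)
  then have "cube \<inter> \<Inter>(D ` pairs) \<noteq> {}"
  proof (rule compact_imp_fip)
    fix T assume "T \<in> D ` pairs"
    then obtain K L where "T = D (K, L)" by auto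
    then show "closed T"
      unfolding D_def subcontent_def prod.case
      by (auto intro!: closed_Collect_conj closed_Collect_all closed_Collect_imp
          closed_Collect_le closed_Collect_eq continuous_intros)
  next
    fix F' assume "finite F'" "F' \<subseteq> D ` pairs"
    then obtain P where P: "finite P" "P \<subseteq> pairs" "F' = D ` P"
      by (meson finite_subset_image)
    obtain \<kappa> where \<kappa>: "subcontent X \<kappa>" "\<forall>h K. h \<in> H \<longrightarrow> closedin X K \<longrightarrow> \<kappa> (h ` K) = \<kappa> K"
        "\<forall>(K, L)\<in>P. \<kappa> (K \<union> L) = \<kappa> K + \<kappa> L"
      using approx[OF P(1,2)] by blast
    then have "\<kappa> \<in> cube \<inter> \<Inter>F'"
      using P(3) subcontent.bounds[OF \<kappa>(1)] by (auto simp: cube_def D_def)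
    then show "cube \<inter> \<Inter>F' \<noteq> {}" by blast
  qed
  then obtain \<kappa> where \<kappa>: "\<And>p. p \<in> pairs \<Longrightarrow> \<kappa> \<in> D p" by blast
  \<comment> \<open>Every set \<open>D p\<close> also records the conditions that do not depend on \<open>p\<close>, so any one pair
    gives them.\<close>
  have "({}, {}) \<in> pairs" by (simp add: pairs_def)
  then have base: "subcontent X \<kappa>" "\<forall>h K. h \<in> H \<longrightarrow> closedin X K \<longrightarrow> \<kappa> (h ` K) = \<kappa> K"
    using \<kappa>[of "({}, {})"] by (auto simp: D_def)
  have "content X \<kappa>"
    using base(1) comp haus \<kappa> by (auto simp: content_def content_axioms_def pairs_def D_def)
  then show ?thesis using base(2) by blast
qed


section \<open>The enveloping semigroup and orbit closures of tuples\<close>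

text \<open>Two disjoint compact sets in a product differ in finitely many coordinates: the open sets
  \<open>{(p, q). p i \<noteq> q i}\<close> cover the compact set \<open>K \<times> L\<close>.\<close>

lemma finitely_many_coordinates_separate:
  assumes haus: "\<And>i. i \<in> I \<Longrightarrow> Hausdorff_space (X i)"
    and K: "compactin (product_topology X I) K" and L: "compactin (product_topology X I) L"
    and disj: "K \<inter> L = {}"
  shows "\<exists>F. finite F \<and> F \<subseteq> I \<and> (\<forall>p\<in>K. \<forall>q\<in>L. \<exists>i\<in>F. p i \<noteq> q i)"
proof -
  let ?T = "product_topology X I"
  let ?TT = "prod_topology ?T ?T"
  define U where "U i = topspace ?TT - {z \<in> topspace ?TT. fst z i = snd z i}" for i
  have "openin ?TT (U i)" if i: "i \<in> I" for i
  proof -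
    have "continuous_map ?TT (X i) ((\<lambda>p. p i) \<circ> fst)" "continuous_map ?TT (X i) ((\<lambda>p. p i) \<circ> snd)"
      using i by (auto intro!: continuous_map_compose continuous_map_fst continuous_map_snd
          continuous_map_product_projection)
    then have "closedin ?TT {z \<in> topspace ?TT. fst z i = snd z i}"
      using closedin_continuous_maps_eq[OF haus[OF i]] unfolding o_def by blast
    then show ?thesis unfolding U_def by blast
  qed
  moreover have "compactin ?TT (K \<times> L)"
    using K L by (simp add: compactin_Times)
  moreover have "K \<times> L \<subseteq> \<Union>(U ` I)"
  proof clarify
    fix p q assume pq: "p \<in> K" "q \<in> L"
    then have top: "p \<in> topspace ?T" "q \<in> topspace ?T"
      using K L compactin_subset_topspace by blast+
    have "p \<noteq> q" using pq disj by auto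
    then obtain i where "i \<in> I" "p i \<noteq> q i"
      using top by (auto dest: PiE_ext)
    then show "(p, q) \<in> \<Union>(U ` I)" using top by (auto simp: U_def)
  qed
  ultimately obtain \<F> where "finite \<F>" "\<F> \<subseteq> U ` I" "K \<times> L \<subseteq> \<Union>\<F>"
    unfolding compactin_def by (metis (no_types, lifting) imageE)
  then obtain F where F: "finite F" "F \<subseteq> I" "K \<times> L \<subseteq> \<Union>(U ` F)"
    by (metis finite_subset_image)
  have "\<exists>i\<in>F. p i \<noteq> q i" if "p \<in> K" "q \<in> L" for p q
  proof -
    have "(p, q) \<in> \<Union>(U ` F)" using F(3) that by blast
    then show ?thesis by (auto simp: U_def)
  qed
  then show ?thesis using F(1,2) by blast
qed

definition evaluate :: "nat \<Rightarrow> (nat \<Rightarrow> 'a) \<Rightarrow> ('a \<Rightarrow> 'a) \<Rightarrow> nat \<Rightarrow> 'a" where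
  "evaluate n x p = (\<lambda>i\<in>{..<n}. p (x i))"

context
  fixes G :: "('g, 'm) monoid_scheme" and X :: "'a topology" and \<phi> :: "'g \<Rightarrow> 'a \<Rightarrow> 'a"
  assumes flow: "G_flow G X \<phi>"
begin

lemma enveloping_subset: "enveloping_semigroup G X \<phi> \<subseteq> topspace X \<rightarrow>\<^sub>E topspace X"
  unfolding enveloping_semigroup_def
  using closure_of_subset_topspace[of "self_maps_space X"] by (simp add: self_maps_space_def)

lemma topspace_enveloping: "topspace (enveloping_space G X \<phi>) = enveloping_semigroup G X \<phi>"
  using enveloping_subset by (auto simp: enveloping_space_def self_maps_space_def)

lemma translation_in_enveloping:
  assumes "g \<in> carrier G"
  shows "\<phi> g \<in> enveloping_semigroup G X \<phi>"
proof -
  have "\<phi> ` carrier G \<subseteq> topspace (self_maps_space X)"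
    using G_flowD(4,6)[OF flow] by (auto simp: self_maps_space_def PiE_def)
  then show ?thesis
    using assms closure_of_subset unfolding enveloping_semigroup_def by blast
qed

lemma enveloping_nonempty: "enveloping_semigroup G X \<phi> \<noteq> {}"
proof -
  interpret group G by (rule G_flowD(1)[OF flow])
  show ?thesis using translation_in_enveloping[OF one_closed] by blast
qed

lemma continuous_map_evaluate:
  assumes x: "x \<in> topspace (power_space X n)"
  shows "continuous_map (self_maps_space X) (power_space X n) (evaluate n x)"
  using x by (auto simp: evaluate_def power_space_def self_maps_space_def
      continuous_map_componentwise PiE_iff intro!: continuous_map_product_projection)

lemma evaluate_equivariant:
  assumes g: "g \<in> carrier G" and x: "x \<in> topspace (power_space X n)"
    and p: "p \<in> enveloping_semigroup G X \<phi>"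
  shows "evaluate n x (enveloping_action G X \<phi> g p) = diagonal_action X \<phi> n g (evaluate n x p)"
proof -
  have "evaluate n x p \<in> topspace (power_space X n)"
    using continuous_map_evaluate[OF x] p enveloping_subset
    by (auto simp: continuous_map_def self_maps_space_def)
  then show ?thesis
    using x p by (auto simp: evaluate_def enveloping_action_def diagonal_action_def compose_def
        power_space_def PiE_iff fun_eq_iff)
qed

lemma evaluate_translation:
  assumes "g \<in> carrier G" "x \<in> topspace (power_space X n)"
  shows "evaluate n x (\<phi> g) = diagonal_action X \<phi> n g x"
  using assms by (auto simp: evaluate_def diagonal_action_def)

text \<open>The map \<open>p \<mapsto> (p x\<^sub>1, \<dots>, p x\<^sub>n)\<close> sends \<open>E(X,G)\<close> onto the orbit closure of
  \<open>(x\<^sub>1, \<dots>, x\<^sub>n)\<close>, hence into each subflow that contains this tuple.\<close>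

lemma evaluate_in_subflow:
  assumes Y: "subflow G (power_space X n) (diagonal_action X \<phi> n) Y" and x: "x \<in> Y"
    and p: "p \<in> enveloping_semigroup G X \<phi>"
  shows "evaluate n x p \<in> Y"
proof -
  have closed: "closedin (power_space X n) Y" using Y by (simp add: subflow_def)
  have xt: "x \<in> topspace (power_space X n)" using closedin_subset[OF closed] x by blast
  have "evaluate n x ` (\<phi> ` carrier G) \<subseteq> Y"
    using Y x evaluate_translation[OF _ xt] by (auto simp: subflow_def)
  then have "power_space X n closure_of (evaluate n x ` (\<phi> ` carrier G)) \<subseteq> Y"
    by (rule closure_of_minimal[OF _ closed])
  then show ?thesis
    using continuous_map_image_closure_subset[OF continuous_map_evaluate[OF xt], of "\<phi> ` carrier G"] p
    unfolding enveloping_semigroup_def by blast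
qed

lemma finitely_power_hereditarily_amenable_if_enveloping_amenable:
  assumes amen: "amenable_flow G (enveloping_space G X \<phi>) (enveloping_action G X \<phi>)"
  shows "finitely_power_hereditarily_amenable G X \<phi>"
  unfolding finitely_power_hereditarily_amenable_def
proof (intro allI impI)
  fix n Y assume Y: "subflow G (power_space X n) (diagonal_action X \<phi> n) Y"
  then obtain x where x: "x \<in> Y" by (auto simp: subflow_def)
  have xt: "x \<in> topspace (power_space X n)"
    using Y x closedin_subset by (fastforce simp: subflow_def)
  show "amenable_flow G (subtopology (power_space X n) Y) (restrict_action (diagonal_action X \<phi> n) Y)"
  proof (rule amenable_flow_equivariant_image[OF amen, where f = "evaluate n x"])
    show "G_flow G (subtopology (power_space X n) Y) (restrict_action (diagonal_action X \<phi> n) Y)"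
      by (rule G_flow_subflow[OF G_flow_power[OF flow] Y])
    show "continuous_map (enveloping_space G X \<phi>) (subtopology (power_space X n) Y) (evaluate n x)"
      using continuous_map_evaluate[OF xt] evaluate_in_subflow[OF Y x] topspace_enveloping
      by (auto simp: continuous_map_in_subtopology enveloping_space_def continuous_map_from_subtopology)
    fix g p assume "g \<in> carrier G" "p \<in> topspace (enveloping_space G X \<phi>)"
    then show "evaluate n x (enveloping_action G X \<phi> g p)
        = restrict_action (diagonal_action X \<phi> n) Y g (evaluate n x p)"
      using evaluate_equivariant[OF _ xt] evaluate_in_subflow[OF Y x] topspace_enveloping
      by (simp add: restrict_action_def)
  qed
qed

text \<open>For a tuple \<open>x\<close>, the image of \<open>E(X,G)\<close> under evaluation at \<open>x\<close> is a subflow of a finite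
  power and carries an invariant measure \<open>\<mu>\<close>. The measure of the image of a closed set is an
  invariant subcontent, additive on those disjoint pairs whose images stay disjoint.\<close>

lemma subcontent_from_tuple:
  assumes amen: "finitely_power_hereditarily_amenable G X \<phi>"
    and n: "n \<ge> 1" and x: "x \<in> topspace (power_space X n)"
  shows "\<exists>\<kappa>. subcontent (enveloping_space G X \<phi>) \<kappa> \<and>
    (\<forall>g\<in>carrier G. \<forall>K. closedin (enveloping_space G X \<phi>) K \<longrightarrow>
       \<kappa> (enveloping_action G X \<phi> g ` K) = \<kappa> K) \<and>
    (\<forall>K L. closedin (enveloping_space G X \<phi>) K \<longrightarrow> closedin (enveloping_space G X \<phi>) L \<longrightarrow>
       evaluate n x ` K \<inter> evaluate n x ` L = {} \<longrightarrow> \<kappa> (K \<union> L) = \<kappa> K + \<kappa> L)"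
proof -
  let ?E = "enveloping_space G X \<phi>"
  let ?ev = "evaluate n x"
  let ?P = "power_space X n"
  note top = topspace_enveloping
  note DE = G_flowD[OF G_flow_enveloping[OF flow]]
  note DP = G_flowD[OF G_flow_power[OF flow, of n]]
  define Y where "Y = ?ev ` enveloping_semigroup G X \<phi>"
  let ?Y = "subtopology ?P Y"
  let ?act = "restrict_action (diagonal_action X \<phi> n) Y"
  have cont: "continuous_map ?E ?P ?ev"
    unfolding enveloping_space_def
    by (rule continuous_map_from_subtopology[OF continuous_map_evaluate[OF x]])
  have "compactin ?E (topspace ?E)" using DE(2) by (simp add: compact_space_def)
  then have "compactin ?P Y"
    unfolding Y_def top using cont by (rule image_compactin)
  then have "closedin ?P Y" by (rule compactin_imp_closedin[OF DP(3)])
  then have subflow: "subflow G ?P (diagonal_action X \<phi> n) Y"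
    using enveloping_nonempty evaluate_equivariant[OF _ x] DE(6) top
    by (auto simp: subflow_def Y_def simp flip: evaluate_equivariant[OF _ x])
  have Ytop: "topspace ?Y = Y"
    using closedin_subset[OF \<open>closedin ?P Y\<close>] by auto
  obtain \<mu> where flowY: "G_flow G ?Y ?act" and \<mu>: "regular_borel_prob ?Y \<mu>"
    and inv: "\<And>g. g \<in> carrier G \<Longrightarrow> distr \<mu> \<mu> (?act g) = \<mu>"
  proof -
    have "amenable_flow G ?Y ?act"
      using amen n subflow by (simp add: finitely_power_hereditarily_amenable_def)
    then show thesis using that by (auto simp: amenable_flow_def)
  qed
  note DY = G_flowD[OF flowY] and R = regular_borel_probD[OF \<mu>]
  interpret prob_space \<mu> by (rule R)
  have "closed_map ?E ?Y ?ev"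
    using DE(2) DY(3) cont
    by (intro continuous_imp_closed_map_gen)
      (auto simp: Hausdorff_imp_kc_space continuous_map_in_subtopology Y_def top)
  then have meas: "?ev ` K \<in> sets \<mu>" if "closedin ?E K" for K
    using that closedin_imp_sets R(2) by (auto simp: closed_map_def)
  define \<kappa> where "\<kappa> K = measure \<mu> (?ev ` K)" for K
  have "subcontent ?E \<kappa>"
  proof
    show "0 \<le> \<kappa> K \<and> \<kappa> K \<le> 1" for K by (simp add: \<kappa>_def)
    show "\<kappa> (topspace ?E) = 1"
      using prob_space R(3) Ytop by (simp add: \<kappa>_def top Y_def)
    fix K L assume KL: "closedin ?E K" "closedin ?E L"
    show "\<kappa> (K \<union> L) \<le> \<kappa> K + \<kappa> L"
      unfolding \<kappa>_def image_Un using KL meas by (intro measure_Un_le) auto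
  qed
  moreover have "\<kappa> (enveloping_action G X \<phi> g ` K) = \<kappa> K"
    if g: "g \<in> carrier G" and K: "closedin ?E K" for g K
  proof -
    let ?C = "?ev ` K"
    have KE: "K \<subseteq> enveloping_semigroup G X \<phi>" using closedin_subset[OF K] top by simp
    then have CY: "?C \<subseteq> Y" by (auto simp: Y_def)
    have image: "?ev ` (enveloping_action G X \<phi> g ` K) = ?act g ` ?C"
      using KE CY evaluate_equivariant[OF g x]
      by (force simp: restrict_action_def image_image subset_iff)
    have m: "?act g \<in> measurable \<mu> \<mu>"
      using continuous_map_measurable[OF DY(5)[OF g]] measurable_cong_sets[OF R(2) R(2)] by simp
    have "?act g ` ?C \<in> sets \<mu>"
      using meas[of "enveloping_action G X \<phi> g ` K"] image K g G_flow_enveloping[OF flow]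
      by (auto simp: G_flow_def closed_map_def dest!: homeomorphic_imp_closed_map)
    then have "measure \<mu> (?act g ` ?C) = measure \<mu> (?act g -` (?act g ` ?C) \<inter> space \<mu>)"
      using measure_distr[OF m] inv[OF g] by metis
    also have "?act g -` (?act g ` ?C) \<inter> space \<mu> = ?C"
    proof -
      have "inj_on (?act g) Y"
        using flowY g Ytop homeomorphic_imp_injective_map[of ?Y ?Y "?act g"]
        by (auto simp: G_flow_def)
      then show ?thesis using CY R(3) Ytop by (auto dest: inj_onD)
    qed
    finally show ?thesis unfolding \<kappa>_def image .
  qed
  moreover have "\<kappa> (K \<union> L) = \<kappa> K + \<kappa> L"
    if "closedin ?E K" "closedin ?E L" "?ev ` K \<inter> ?ev ` L = {}" for K L
    unfolding \<kappa>_def image_Un using that meas by (intro finite_measure_Union) auto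
  ultimately show ?thesis by blast
qed

lemma enveloping_amenable_if_finitely_power_hereditarily_amenable:
  assumes amen: "finitely_power_hereditarily_amenable G X \<phi>"
  shows "amenable_flow G (enveloping_space G X \<phi>) (enveloping_action G X \<phi>)"
proof -
  let ?E = "enveloping_space G X \<phi>"
  let ?act = "enveloping_action G X \<phi>"
  note flowE = G_flow_enveloping[OF flow]
  note DE = G_flowD[OF flowE]
  note top = topspace_enveloping
  have "\<exists>\<kappa>. content ?E \<kappa> \<and> (\<forall>h K. h \<in> ?act ` carrier G \<longrightarrow> closedin ?E K \<longrightarrow> \<kappa> (h ` K) = \<kappa> K)"
  proof (rule content_by_compactness[OF DE(2,3)])
    fix P assume P: "finite P" "P \<subseteq> {(K, L). closedin ?E K \<and> closedin ?E L \<and> K \<inter> L = {}}"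
    show "\<exists>\<kappa>. subcontent ?E \<kappa> \<and> (\<forall>h K. h \<in> ?act ` carrier G \<longrightarrow> closedin ?E K \<longrightarrow> \<kappa> (h ` K) = \<kappa> K) \<and>
        (\<forall>(K, L)\<in>P. \<kappa> (K \<union> L) = \<kappa> K + \<kappa> L)"
    proof (cases "topspace X = {}")
      case True
      \<comment> \<open>Here no positive power of \<open>X\<close> has a subflow, but \<open>E(X,G)\<close> is a single point.\<close>
      have single: "K = {} \<or> K = {\<lambda>_. undefined}" if "closedin ?E K" for K
        using closedin_subset[OF that] enveloping_subset True by (auto simp: top)
      define \<kappa> :: "('a \<Rightarrow> 'a) set \<Rightarrow> real" where "\<kappa> K = (if K = {} then 0 else 1)" for K
      have "subcontent ?E \<kappa>"
        using enveloping_nonempty by unfold_locales (auto simp: \<kappa>_def top)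
      moreover have "\<kappa> (K \<union> L) = \<kappa> K + \<kappa> L" if "(K, L) \<in> P" for K L
        using P(2) that single[of K] single[of L] by (auto simp: \<kappa>_def)
      moreover have "\<kappa> (h ` K) = \<kappa> K" for h K by (simp add: \<kappa>_def)
      ultimately show ?thesis by blast
    next
      case False
      then obtain a where a: "a \<in> topspace X" by blast
      have sep: "\<exists>F. finite F \<and> F \<subseteq> topspace X \<and> (\<forall>p\<in>fst z. \<forall>q\<in>snd z. \<exists>i\<in>F. p i \<noteq> q i)"
        if z: "z \<in> P" for z
      proof -
        have "compactin (self_maps_space X) K" if "closedin ?E K" for K
          using closedin_compact_space[OF DE(2) that]
          by (simp add: enveloping_space_def compactin_subtopology)
        moreover have "closedin ?E (fst z)" "closedin ?E (snd z)" "fst z \<inter> snd z = {}"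
          using subsetD[OF P(2) z] by auto
        ultimately show ?thesis
          using G_flowD(3)[OF flow] unfolding self_maps_space_def
          by (intro finitely_many_coordinates_separate) simp_all
      qed
      then obtain F where F: "\<And>z. z \<in> P \<Longrightarrow> finite (F z) \<and> F z \<subseteq> topspace X \<and>
          (\<forall>p\<in>fst z. \<forall>q\<in>snd z. \<exists>i\<in>F z. p i \<noteq> q i)"
        by metis
      \<comment> \<open>The point \<open>a\<close> makes the tuple nonempty even if \<open>P\<close> requires no coordinates.\<close>
      define S where "S = insert a (\<Union>z\<in>P. F z)"
      have S: "finite S" "S \<subseteq> topspace X" using F P(1) a by (auto simp: S_def)
      obtain y where y: "bij_betw y {0..<card S} S"
        using ex_bij_betw_nat_finite[OF S(1)] by blast
      define n where "n = card S"
      define x where "x = restrict y {..<n}"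
      have n: "n \<ge> 1"
        using S(1) by (simp add: n_def S_def card_gt_0_iff Suc_le_eq)
      have ximage: "x ` {..<n} = S"
        using y by (simp add: x_def n_def bij_betw_def lessThan_atLeast0)
      have x: "x \<in> topspace (power_space X n)"
        using ximage S(2) by (auto simp: power_space_def x_def)
      have disj: "evaluate n x ` K \<inter> evaluate n x ` L = {}" if KL: "(K, L) \<in> P" for K L
      proof -
        have "evaluate n x p \<noteq> evaluate n x q" if pq: "p \<in> K" "q \<in> L" for p q
        proof -
          obtain s where s: "s \<in> F (K, L)" "p s \<noteq> q s"
            using F[OF KL, unfolded fst_conv snd_conv] pq by blast
          then obtain i where "i < n" "s = x i" using KL ximage by (force simp: S_def)
          then show ?thesis using s by (auto simp: evaluate_def fun_eq_iff)
        qed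
        then show ?thesis by blast
      qed
      obtain \<kappa> where \<kappa>: "subcontent ?E \<kappa>"
        and inv: "\<And>g K. g \<in> carrier G \<Longrightarrow> closedin ?E K \<Longrightarrow> \<kappa> (?act g ` K) = \<kappa> K"
        and add: "\<And>K L. closedin ?E K \<Longrightarrow> closedin ?E L \<Longrightarrow>
          evaluate n x ` K \<inter> evaluate n x ` L = {} \<Longrightarrow> \<kappa> (K \<union> L) = \<kappa> K + \<kappa> L"
        using subcontent_from_tuple[OF amen n x] by blast
      have "\<kappa> (K \<union> L) = \<kappa> K + \<kappa> L" if KL: "(K, L) \<in> P" for K L
        using add[OF _ _ disj[OF KL]] subsetD[OF P(2) KL] by simp
      then show ?thesis using \<kappa> inv by (intro exI[of _ \<kappa>]) auto
    qed
  qed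
  then obtain \<kappa> where \<kappa>: "content ?E \<kappa>"
    and inv: "\<And>g K. g \<in> carrier G \<Longrightarrow> closedin ?E K \<Longrightarrow> \<kappa> (?act g ` K) = \<kappa> K"
    by blast
  show ?thesis by (rule amenable_flow_if_invariant_content[OF flowE \<kappa> inv])
qed

end

theorem theorem5p3:
  fixes G :: "('g, 'm) monoid_scheme"
    and X :: "'a topology"
    and \<phi> :: "'g \<Rightarrow> 'a \<Rightarrow> 'a"
  assumes "G_flow G X \<phi>"
  shows "amenable_flow G (enveloping_space G X \<phi>) (enveloping_action G X \<phi>)
    \<longleftrightarrow> finitely_power_hereditarily_amenable G X \<phi>"
  using finitely_power_hereditarily_amenable_if_enveloping_amenable[OF assms]
    enveloping_amenable_if_finitely_power_hereditarily_amenable[OF assms]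
  by blast

end
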